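(* Let $k\geq1$ and let $\delta\in\mathbb{R}^{k\times k}$ be a matrix such that for every $i_0,j_0\in[k]$, $\sum_{j\in[k]}\delta_{i_0,j}=\sum_{i\in[k]}\delta_{i,j_0}=0$. Let $X=(X_1,\dots,X_k)$ and $Y=(Y_1,\dots,Y_k)$ be independent random vectors, each uniformly distributed over $\{0,1\}^k$, and define $Z=\sum_{(i,j)\in[k]\times[k]}\delta_{ij}X_iY_j$. Then for every $\alpha\in(0,1/16)$ there exists a constant $c_\alpha>0$ (not depending on $k$ or $\delta$) such that $$\Pr\big[Z^2\geq\alpha\|\delta\|_F^2\big]\geq c_\alpha.$$ Moreover, one can take $c_\alpha=\frac{(1-16\alpha)^2}{1024}$.
   Context: $[k]=\{1,\dots,k\}$; $\|\delta\|_F=\big(\sum_{i,j}\delta_{ij}^2\big)^{1/2}$ is the Frobenius norm. *)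

theory Defs
  imports "HOL-Probability.Probability"
begin

text \<open>
  A real \<open>k \<times> k\<close> matrix is a function \<open>nat \<Rightarrow> nat \<Rightarrow> real\<close>, of which only the entries with both
  indices in \<open>{1..k}\<close> are ever used; the size has to be a number rather than a type because the
  constant is chosen before \<open>k\<close>.
\<close>

definition zero_line_sums :: "nat \<Rightarrow> (nat \<Rightarrow> nat \<Rightarrow> real) \<Rightarrow> bool" where
  "zero_line_sums k \<delta> \<longleftrightarrow>
     (\<forall>i0\<in>{1..k}. \<forall>j0\<in>{1..k}. (\<Sum>j\<in>{1..k}. \<delta> i0 j) = 0 \<and> (\<Sum>i\<in>{1..k}. \<delta> i j0) = 0)"

definition frob_norm :: "nat \<Rightarrow> (nat \<Rightarrow> nat \<Rightarrow> real) \<Rightarrow> real" where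
  "frob_norm k \<delta> = sqrt (\<Sum>(i, j)\<in>{1..k} \<times> {1..k}. (\<delta> i j)\<^sup>2)"

definition bilin :: "nat \<Rightarrow> (nat \<Rightarrow> nat \<Rightarrow> real) \<Rightarrow> (nat \<Rightarrow> real) \<Rightarrow> (nat \<Rightarrow> real) \<Rightarrow> real" where
  "bilin k \<delta> x y = (\<Sum>(i, j)\<in>{1..k} \<times> {1..k}. \<delta> i j * x i * y j)"

definition cube :: "nat \<Rightarrow> (nat \<Rightarrow> real) set" where
  "cube k = {1..k} \<rightarrow>\<^sub>E {0, 1}"

text \<open>Measurability of both vectors is part of \<^const>\<open>prob_space.indep_var\<close>.\<close>

definition indep_uniform_cube ::
  "'a measure \<Rightarrow> nat \<Rightarrow> ('a \<Rightarrow> nat \<Rightarrow> real) \<Rightarrow> ('a \<Rightarrow> nat \<Rightarrow> real) \<Rightarrow> bool" where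
  "indep_uniform_cube M k X Y \<longleftrightarrow>
     prob_space M \<and>
     prob_space.indep_var M (count_space (cube k)) X (count_space (cube k)) Y \<and>
     distr M (count_space (cube k)) X = uniform_count_measure (cube k) \<and>
     distr M (count_space (cube k)) Y = uniform_count_measure (cube k)"

end

theory Submission
  imports Defs
begin

text \<open>
  Put \<open>s = 2 x - 1\<close> and \<open>t = 2 y - 1\<close>, so that \<open>s\<close> and \<open>t\<close> are sign vectors. As the line sums
  vanish, \<open>Z\<close> is a quarter of \<open>W = \<Sum>\<^sub>i\<^sub>j \<delta>\<^sub>i\<^sub>j s\<^sub>i t\<^sub>j\<close>. The second moment of \<open>W\<close> is \<open>\<parallel>\<delta>\<parallel>\<^sub>F\<^sup>2\<close>, and the
  Khintchine inequality with exponent 4, applied once in each of the two vectors, bounds the fourth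
  moment by \<open>9 \<parallel>\<delta>\<parallel>\<^sub>F\<^sup>4\<close>. The Paley-Zygmund inequality for \<open>W\<^sup>2\<close> then yields the probability bound
  \<open>(1 - 16 \<alpha>)\<^sup>2 / 9\<close>.
\<close>

section \<open>Moments of linear forms in random signs\<close>

lemma sum_PiE_insert:
  fixes f :: "('a \<Rightarrow> real) \<Rightarrow> real"
  assumes "finite I" "i \<notin> I"
  shows "(\<Sum>x\<in>insert i I \<rightarrow>\<^sub>E {0, 1}. f x) = (\<Sum>x\<in>I \<rightarrow>\<^sub>E {0, 1}. f (x(i := 0)) + f (x(i := 1)))"
proof -
  have inj: "inj_on (\<lambda>(y, g). g(i := y)) ({0, 1::real} \<times> (I \<rightarrow>\<^sub>E {0, 1}))"
    using inj_combinator[OF assms(2), of "\<lambda>_. {0, 1}"] by simp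
  show ?thesis
    unfolding PiE_insert_eq
    by (subst sum.reindex[OF inj]) (simp add: sum.cartesian_product' sum.distrib)
qed

text \<open>Points stay in \<open>{0, 1}\<close>, as in \<open>cube\<close>; the signs
  \<open>2 * x i - 1\<close> enter only through the formula, so no transport between a 0/1 cube and
  a sign cube is needed.\<close>

definition sign_sum :: "'a set \<Rightarrow> ('a \<Rightarrow> real) \<Rightarrow> ('a \<Rightarrow> real) \<Rightarrow> real" where
  "sign_sum I a x = (\<Sum>i\<in>I. a i * (2 * x i - 1))"

lemma sign_sum_insert_upd:
  assumes "finite I" "i \<notin> I"
  shows "sign_sum (insert i I) a (x(i := c)) = a i * (2 * c - 1) + sign_sum I a x"
proof -
  have "(\<Sum>j\<in>I. a j * (2 * (x(i := c)) j - 1)) = (\<Sum>j\<in>I. a j * (2 * x j - 1))"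
    using assms(2) by (intro sum.cong) auto
  then show ?thesis
    using assms by (simp add: sign_sum_def)
qed

lemma card_PiE_01:
  assumes "finite I"
  shows "card (I \<rightarrow>\<^sub>E {0, 1::real}) = 2 ^ card I"
  using assms by (simp add: card_PiE numeral_2_eq_2)

text \<open>Distinct signs are orthogonal: when the new coordinate takes both its values, the cross
  terms of \<open>(s + a)^2\<close> and \<open>(s - a)^2\<close> cancel.\<close>

lemma sum_sign_sum_power2:
  assumes "finite I"
  shows "(\<Sum>x\<in>I \<rightarrow>\<^sub>E {0, 1}. (sign_sum I a x)\<^sup>2) = 2 ^ card I * (\<Sum>i\<in>I. (a i)\<^sup>2)"
  using assms
proof (induction I rule: finite_induct)
  case empty
  then show ?case by (simp add: sign_sum_def)
next
  case (insert i I)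
  have "(\<Sum>x\<in>insert i I \<rightarrow>\<^sub>E {0, 1}. (sign_sum (insert i I) a x)\<^sup>2)
      = (\<Sum>x\<in>I \<rightarrow>\<^sub>E {0, 1}. 2 * (a i)\<^sup>2 + 2 * (sign_sum I a x)\<^sup>2)"
    unfolding sum_PiE_insert[OF insert(1,2)] sign_sum_insert_upd[OF insert(1,2)]
    by (intro sum.cong) (auto simp: power2_eq_square algebra_simps)
  also have "\<dots> = 2 ^ card I * (2 * (a i)\<^sup>2) + 2 * (2 ^ card I * (\<Sum>i\<in>I. (a i)\<^sup>2))"
    unfolding insert.IH[symmetric]
    by (simp add: sum.distrib sum_distrib_left[symmetric] card_PiE_01[OF insert(1)])
  also have "\<dots> = 2 ^ card (insert i I) * (\<Sum>i\<in>insert i I. (a i)\<^sup>2)"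
    using insert by (simp add: algebra_simps)
  finally show ?case .
qed

text \<open>Khintchine's inequality with exponent 4 and constant 3. In
  \<open>(s + a)^4 + (s - a)^4\<close> the odd powers cancel; what remains is controlled by the
  exact second moment for \<open>s^2\<close> and the induction hypothesis for
  \<open>s^4\<close>.\<close>

lemma sum_sign_sum_power4_le:
  assumes "finite I"
  shows "(\<Sum>x\<in>I \<rightarrow>\<^sub>E {0, 1}. (sign_sum I a x) ^ 4) \<le> 3 * 2 ^ card I * (\<Sum>i\<in>I. (a i)\<^sup>2)\<^sup>2"
  using assms
proof (induction I rule: finite_induct)
  case empty
  then show ?case by (simp add: sign_sum_def)
next
  case (insert i I)
  let ?A = "\<Sum>i\<in>I. (a i)\<^sup>2"
  have "(\<Sum>x\<in>insert i I \<rightarrow>\<^sub>E {0, 1}. (sign_sum (insert i I) a x) ^ 4)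
      = (\<Sum>x\<in>I \<rightarrow>\<^sub>E {0, 1}. 2 * (a i) ^ 4 + 12 * (a i)\<^sup>2 * (sign_sum I a x)\<^sup>2
          + 2 * (sign_sum I a x) ^ 4)"
    unfolding sum_PiE_insert[OF insert(1,2)] sign_sum_insert_upd[OF insert(1,2)]
    by (intro sum.cong) (auto simp: power2_eq_square power4_eq_xxxx algebra_simps)
  also have "\<dots> = 2 ^ card I * (2 * (a i) ^ 4) + 12 * (a i)\<^sup>2 * (2 ^ card I * ?A)
      + 2 * (\<Sum>x\<in>I \<rightarrow>\<^sub>E {0, 1}. (sign_sum I a x) ^ 4)"
    unfolding sum_sign_sum_power2[OF insert(1), symmetric]
    by (simp add: sum.distrib sum_distrib_left[symmetric] card_PiE_01[OF insert(1)])
  also have "\<dots> \<le> 2 ^ card I * (2 * (a i) ^ 4) + 12 * (a i)\<^sup>2 * (2 ^ card I * ?A)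
      + 2 * (3 * 2 ^ card I * ?A\<^sup>2)"
    using insert.IH by simp
  also have "\<dots> = 2 ^ card I * (2 * (a i) ^ 4 + 12 * (a i)\<^sup>2 * ?A + 6 * ?A\<^sup>2)"
    by (simp add: algebra_simps)
  \<comment> \<open>The constant 3 is chosen so that the mixed term \<open>12 * (a i)^2 * ?A\<close>
    is exactly that of the square; only \<open>2 * (a i) ^ 4\<close> is enlarged, to
    \<open>6 * (a i) ^ 4\<close>.\<close>
  also have "\<dots> \<le> 2 ^ card I * (6 * ((a i)\<^sup>2 + ?A)\<^sup>2)"
  proof -
    have "6 * ((a i)\<^sup>2 + ?A)\<^sup>2 = 6 * (a i) ^ 4 + 12 * (a i)\<^sup>2 * ?A + 6 * ?A\<^sup>2"
      by (simp add: power2_eq_square power4_eq_xxxx algebra_simps)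
    moreover have "0 \<le> (a i) ^ 4"
      by simp
    ultimately show ?thesis
      by (intro mult_left_mono) (linarith, simp)
  qed
  also have "\<dots> = 3 * 2 ^ card (insert i I) * (\<Sum>i\<in>insert i I. (a i)\<^sup>2)\<^sup>2"
    using insert by simp
  finally show ?case .
qed

text \<open>Cauchy-Schwarz reduces the mixed moment to two fourth moments. The squares of the two
  sides are compared, and the root is taken at the level of the inequality. Such mixed moments arise
  when the square of a sum of squared linear forms is expanded.\<close>

lemma sum_sign_sum_power2_mult_le:
  assumes "finite I"
  shows "(\<Sum>x\<in>I \<rightarrow>\<^sub>E {0, 1}. (sign_sum I a x)\<^sup>2 * (sign_sum I b x)\<^sup>2)
    \<le> 3 * 2 ^ card I * (\<Sum>i\<in>I. (a i)\<^sup>2) * (\<Sum>i\<in>I. (b i)\<^sup>2)"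
proof (rule power2_le_imp_le)
  let ?C = "I \<rightarrow>\<^sub>E {0, 1::real}" and ?A = "\<Sum>i\<in>I. (a i)\<^sup>2" and ?B = "\<Sum>i\<in>I. (b i)\<^sup>2"
  have "(\<Sum>x\<in>?C. (sign_sum I a x)\<^sup>2 * (sign_sum I b x)\<^sup>2)\<^sup>2
      \<le> (\<Sum>x\<in>?C. ((sign_sum I a x)\<^sup>2)\<^sup>2) * (\<Sum>x\<in>?C. ((sign_sum I b x)\<^sup>2)\<^sup>2)"
    by (rule Cauchy_Schwarz_ineq_sum)
  also have "\<dots> = (\<Sum>x\<in>?C. (sign_sum I a x) ^ 4) * (\<Sum>x\<in>?C. (sign_sum I b x) ^ 4)"
    by simp
  also have "\<dots> \<le> (3 * 2 ^ card I * ?A\<^sup>2) * (3 * 2 ^ card I * ?B\<^sup>2)"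
    by (intro mult_mono sum_sign_sum_power4_le assms) (auto intro: sum_nonneg)
  also have "\<dots> = (3 * 2 ^ card I * ?A * ?B)\<^sup>2"
    by (simp add: power2_eq_square algebra_simps)
  finally show "(\<Sum>x\<in>?C. (sign_sum I a x)\<^sup>2 * (sign_sum I b x)\<^sup>2)\<^sup>2 \<le> (3 * 2 ^ card I * ?A * ?B)\<^sup>2" .
  show "0 \<le> 3 * 2 ^ card I * ?A * ?B"
    by (intro mult_nonneg_nonneg sum_nonneg) auto
qed

section \<open>Moments of bilinear forms in random signs\<close>

definition sign_form :: "'a set \<Rightarrow> 'b set \<Rightarrow> ('a \<Rightarrow> 'b \<Rightarrow> real) \<Rightarrow> ('a \<Rightarrow> real) \<Rightarrow> ('b \<Rightarrow> real) \<Rightarrow> real"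
  where "sign_form I J d x y = sign_sum J (\<lambda>j. sign_sum I (\<lambda>i. d i j) x) y"

text \<open>For fixed \<open>x\<close> the form is linear in the signs of \<open>y\<close>, with
  coefficients that are linear in the signs of \<open>x\<close>. The one-vector identity is
  therefore used first in \<open>y\<close>, then in \<open>x\<close> for each coefficient.\<close>

lemma sum_sign_form_power2:
  assumes "finite I" "finite J"
  shows "(\<Sum>x\<in>I \<rightarrow>\<^sub>E {0, 1}. \<Sum>y\<in>J \<rightarrow>\<^sub>E {0, 1}. (sign_form I J d x y)\<^sup>2)
    = 2 ^ card I * 2 ^ card J * (\<Sum>i\<in>I. \<Sum>j\<in>J. (d i j)\<^sup>2)"
proof -
  have "(\<Sum>x\<in>I \<rightarrow>\<^sub>E {0, 1}. \<Sum>y\<in>J \<rightarrow>\<^sub>E {0, 1}. (sign_form I J d x y)\<^sup>2)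
      = 2 ^ card J * (\<Sum>x\<in>I \<rightarrow>\<^sub>E {0, 1}. \<Sum>j\<in>J. (sign_sum I (\<lambda>i. d i j) x)\<^sup>2)"
    by (simp add: sign_form_def sum_sign_sum_power2[OF assms(2)] sum_distrib_left[symmetric])
  also have "\<dots> = 2 ^ card J * (\<Sum>j\<in>J. 2 ^ card I * (\<Sum>i\<in>I. (d i j)\<^sup>2))"
    by (subst sum.swap) (simp add: sum_sign_sum_power2[OF assms(1)])
  also have "\<dots> = 2 ^ card I * 2 ^ card J * (\<Sum>i\<in>I. \<Sum>j\<in>J. (d i j)\<^sup>2)"
    by (simp add: sum_distrib_left[symmetric] sum.swap[of _ J I])
  finally show ?thesis .
qed

text \<open>Khintchine in \<open>y\<close>, for fixed \<open>x\<close>, leaves the squared sum of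
  the \<open>(?b j x)^2\<close>; expanding this square and bounding the mixed moments over
  \<open>x\<close> costs a second factor 3, whence 9.\<close>

lemma sum_sign_form_power4_le:
  assumes "finite I" "finite J"
  shows "(\<Sum>x\<in>I \<rightarrow>\<^sub>E {0, 1}. \<Sum>y\<in>J \<rightarrow>\<^sub>E {0, 1}. (sign_form I J d x y) ^ 4)
    \<le> 9 * (2 ^ card I * 2 ^ card J) * (\<Sum>i\<in>I. \<Sum>j\<in>J. (d i j)\<^sup>2)\<^sup>2"
proof -
  let ?b = "\<lambda>j x. sign_sum I (\<lambda>i. d i j) x" and ?u = "\<lambda>j. \<Sum>i\<in>I. (d i j)\<^sup>2"
  have "(\<Sum>x\<in>I \<rightarrow>\<^sub>E {0, 1}. (\<Sum>j\<in>J. (?b j x)\<^sup>2)\<^sup>2)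
      = (\<Sum>x\<in>I \<rightarrow>\<^sub>E {0, 1}. \<Sum>j\<in>J. \<Sum>l\<in>J. (?b j x)\<^sup>2 * (?b l x)\<^sup>2)"
    by (simp add: power2_eq_square[of "sum _ _"] sum_product)
  also have "\<dots> = (\<Sum>j\<in>J. \<Sum>l\<in>J. \<Sum>x\<in>I \<rightarrow>\<^sub>E {0, 1}. (?b j x)\<^sup>2 * (?b l x)\<^sup>2)"
    by (subst sum.swap, rule sum.cong[OF refl], rule sum.swap)
  also have "\<dots> \<le> (\<Sum>j\<in>J. \<Sum>l\<in>J. 3 * 2 ^ card I * ?u j * ?u l)"
    by (intro sum_mono sum_sign_sum_power2_mult_le assms)
  \<comment> \<open>The bound for the pair \<open>j\<close>, \<open>l\<close> is a product of a term
    in \<open>j\<close> and a term in \<open>l\<close>, so the double sum folds back into a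
    square.\<close>
  also have "\<dots> = 3 * 2 ^ card I * (\<Sum>j\<in>J. ?u j)\<^sup>2"
    by (simp only: power2_eq_square[of "sum _ J"] sum_product sum_distrib_left[symmetric] mult.assoc)
  finally have *: "(\<Sum>x\<in>I \<rightarrow>\<^sub>E {0, 1}. (\<Sum>j\<in>J. (?b j x)\<^sup>2)\<^sup>2) \<le> 3 * 2 ^ card I * (\<Sum>j\<in>J. ?u j)\<^sup>2" .
  have "(\<Sum>x\<in>I \<rightarrow>\<^sub>E {0, 1}. \<Sum>y\<in>J \<rightarrow>\<^sub>E {0, 1}. (sign_form I J d x y) ^ 4)
      \<le> (\<Sum>x\<in>I \<rightarrow>\<^sub>E {0, 1}. 3 * 2 ^ card J * (\<Sum>j\<in>J. (?b j x)\<^sup>2)\<^sup>2)"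
    unfolding sign_form_def by (intro sum_mono sum_sign_sum_power4_le assms)
  also have "\<dots> = 3 * 2 ^ card J * (\<Sum>x\<in>I \<rightarrow>\<^sub>E {0, 1}. (\<Sum>j\<in>J. (?b j x)\<^sup>2)\<^sup>2)"
    by (simp add: sum_distrib_left)
  also have "\<dots> \<le> 3 * 2 ^ card J * (3 * 2 ^ card I * (\<Sum>j\<in>J. ?u j)\<^sup>2)"
    by (intro mult_left_mono *) auto
  also have "(\<Sum>j\<in>J. ?u j) = (\<Sum>i\<in>I. \<Sum>j\<in>J. (d i j)\<^sup>2)"
    by (rule sum.swap)
  finally show ?thesis
    by (simp add: mult_ac)
qed

section \<open>The Paley-Zygmund inequality and its use on the cube\<close>

text \<open>Here \<open>m\<close> is the mean of \<open>f\<close> under the uniform distribution on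
  \<open>Q\<close>. Elements below the threshold contribute at most
  \<open>card Q * (\<theta> * m)\<close>, so the others carry at least the fraction
  \<open>1 - \<theta>\<close> of the total; by Cauchy-Schwarz and the bound on the second moment, a
  few elements cannot carry that much.\<close>

lemma Paley_Zygmund_card:
  fixes f :: "'a \<Rightarrow> real" and m K \<theta> :: real
  assumes "finite Q" and mean: "(\<Sum>q\<in>Q. f q) = card Q * m" and "0 < m"
    and square: "(\<Sum>q\<in>Q. (f q)\<^sup>2) \<le> K * (card Q * m\<^sup>2)"
    and "0 \<le> \<theta>" "\<theta> \<le> 1"
  shows "(1 - \<theta>)\<^sup>2 * card Q \<le> K * card {q \<in> Q. \<theta> * m \<le> f q}"
proof (cases "card Q = 0")
  case True
  then show ?thesis
    using \<open>finite Q\<close> by simp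
next
  case False
  let ?G = "{q \<in> Q. \<theta> * m \<le> f q}"
  have "(\<Sum>q\<in>Q. f q) = (\<Sum>q\<in>Q - ?G. f q) + (\<Sum>q\<in>?G. f q)"
    using \<open>finite Q\<close> by (intro sum.subset_diff) auto
  also have "(\<Sum>q\<in>Q - ?G. f q) \<le> (\<Sum>q\<in>Q - ?G. \<theta> * m)"
    by (intro sum_mono) auto
  also have "\<dots> \<le> card Q * (\<theta> * m)"
    using assms by (auto intro!: mult_right_mono card_mono)
  finally have "(1 - \<theta>) * (card Q * m) \<le> (\<Sum>q\<in>?G. f q)"
    using mean by (simp add: algebra_simps)
  then have "((1 - \<theta>) * (card Q * m))\<^sup>2 \<le> (\<Sum>q\<in>?G. f q)\<^sup>2"
    using assms by (intro power_mono) auto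
  also have "\<dots> \<le> card ?G * (\<Sum>q\<in>?G. (f q)\<^sup>2)"
    using Cauchy_Schwarz_ineq_sum[of "\<lambda>_. 1" f ?G] by simp
  also have "\<dots> \<le> card ?G * (\<Sum>q\<in>Q. (f q)\<^sup>2)"
    using \<open>finite Q\<close> by (intro mult_left_mono sum_mono2) auto
  also have "\<dots> \<le> card ?G * (K * (card Q * m\<^sup>2))"
    by (intro mult_left_mono square) auto
  finally have "((1 - \<theta>)\<^sup>2 * card Q) * (card Q * m\<^sup>2) \<le> (K * card ?G) * (card Q * m\<^sup>2)"
    by (simp add: power2_eq_square mult_ac)
  \<comment> \<open>The common factor \<open>card Q * m^2\<close> is positive because
    \<open>Q\<close> is nonempty in this case and \<open>0 < m\<close>.\<close>
  then show ?thesis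
    using False \<open>0 < m\<close> by (subst (asm) mult_le_cancel_right_pos) auto
qed

text \<open>Of the four terms in \<open>(2 * x i - 1) * (2 * y j - 1)\<close> only
  \<open>4 * x i * y j\<close> survives summation: the column sums cancel the -1 next to
  \<open>x\<close>, and the row sums cancel the -1 next to \<open>y\<close>.\<close>

lemma bilin_eq_sign_form:
  assumes "zero_line_sums k \<delta>"
  shows "bilin k \<delta> x y = sign_form {1..k} {1..k} \<delta> x y / 4"
proof -
  have row: "(\<Sum>j\<in>{1..k}. \<delta> i j) = 0" and col: "(\<Sum>i\<in>{1..k}. \<delta> i j) = 0"
    if "i \<in> {1..k}" "j \<in> {1..k}" for i j
    using assms that by (auto simp: zero_line_sums_def)
  have "sign_form {1..k} {1..k} \<delta> x y
      = (\<Sum>j\<in>{1..k}. (2 * (\<Sum>i\<in>{1..k}. \<delta> i j * x i)) * (2 * y j - 1))"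
    unfolding sign_form_def sign_sum_def
  proof (intro sum.cong refl arg_cong2[where f = "(*)"])
    fix j assume "j \<in> {1..k}"
    then have "(\<Sum>i\<in>{1..k}. \<delta> i j) = 0"
      using col by blast
    then show "(\<Sum>i\<in>{1..k}. \<delta> i j * (2 * x i - 1)) = 2 * (\<Sum>i\<in>{1..k}. \<delta> i j * x i)"
      by (simp add: algebra_simps sum_subtractf sum_distrib_left)
  qed
  also have "\<dots> = 4 * (\<Sum>j\<in>{1..k}. \<Sum>i\<in>{1..k}. \<delta> i j * x i * y j)
      - 2 * (\<Sum>j\<in>{1..k}. \<Sum>i\<in>{1..k}. \<delta> i j * x i)"
    by (simp add: algebra_simps sum_subtractf sum_distrib_left sum_distrib_right)
  also have "(\<Sum>j\<in>{1..k}. \<Sum>i\<in>{1..k}. \<delta> i j * x i) = (\<Sum>i\<in>{1..k}. x i * (\<Sum>j\<in>{1..k}. \<delta> i j))"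
    by (subst sum.swap) (simp add: sum_distrib_left mult.commute)
  also have "\<dots> = 0"
    using row by (intro sum.neutral ballI) (metis mult_zero_right)
  also have "(\<Sum>j\<in>{1..k}. \<Sum>i\<in>{1..k}. \<delta> i j * x i * y j) = bilin k \<delta> x y"
    unfolding bilin_def by (subst sum.swap) (simp add: sum.cartesian_product)
  finally show ?thesis
    by simp
qed

lemma frob_norm_power2: "(frob_norm k \<delta>)\<^sup>2 = (\<Sum>i\<in>{1..k}. \<Sum>j\<in>{1..k}. (\<delta> i j)\<^sup>2)"
proof -
  have "0 \<le> (\<Sum>(i, j)\<in>{1..k} \<times> {1..k}. (\<delta> i j)\<^sup>2)"
    by (intro sum_nonneg) auto
  then show ?thesis
    by (simp add: frob_norm_def sum.cartesian_product)
qed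

lemma finite_cube: "finite (cube k)"
  by (simp add: cube_def finite_PiE)

lemma card_cube: "card (cube k) = 2 ^ k"
  by (simp add: cube_def card_PiE_01)

text \<open>Paley-Zygmund on \<open>cube k \<times> cube k\<close> for the square of the sign form,
  with mean \<open>(frob_norm k \<delta>)^2\<close>, \<open>K = 9\<close> and threshold fraction
  \<open>16 * \<alpha>\<close>.\<close>

lemma card_bilin_ge:
  fixes \<alpha> :: real
  assumes "zero_line_sums k \<delta>" "0 \<le> \<alpha>" "\<alpha> \<le> 1 / 16"
  shows "(1 - 16 * \<alpha>)\<^sup>2 * card (cube k \<times> cube k)
    \<le> 9 * real (card {(x, y) \<in> cube k \<times> cube k. (bilin k \<delta> x y)\<^sup>2 \<ge> \<alpha> * (frob_norm k \<delta>)\<^sup>2})"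
proof (cases "frob_norm k \<delta> = 0")
  case True
  \<comment> \<open>The zero matrix is treated apart, as Paley-Zygmund asks for a positive mean;
    here every pair qualifies.\<close>
  have "{(x, y) \<in> cube k \<times> cube k. (bilin k \<delta> x y)\<^sup>2 \<ge> \<alpha> * (frob_norm k \<delta>)\<^sup>2} = cube k \<times> cube k"
    using True by auto
  moreover have "(1 - 16 * \<alpha>)\<^sup>2 \<le> 9"
    using assms by (intro order.trans[OF power_le_one]) auto
  ultimately show ?thesis
    by (auto intro: mult_right_mono)
next
  case False
  let ?Q = "cube k \<times> cube k" and ?W = "sign_form {1..k} {1..k} \<delta>" and ?F = "(frob_norm k \<delta>)\<^sup>2"
  have cardQ: "real (card ?Q) = 2 ^ k * 2 ^ k"
    by (simp add: card_cartesian_product card_cube)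
  have "(1 - 16 * \<alpha>)\<^sup>2 * card ?Q
      \<le> 9 * real (card {q \<in> ?Q. (16 * \<alpha>) * ?F \<le> (case q of (x, y) \<Rightarrow> (?W x y)\<^sup>2)})"
  proof (rule Paley_Zygmund_card)
    show "(\<Sum>q\<in>?Q. case q of (x, y) \<Rightarrow> (?W x y)\<^sup>2) = card ?Q * ?F"
      using sum_sign_form_power2[of "{1..k}" "{1..k}" \<delta>]
      unfolding cardQ by (simp add: sum.cartesian_product[symmetric] cube_def frob_norm_power2)
    show "(\<Sum>q\<in>?Q. (case q of (x, y) \<Rightarrow> (?W x y)\<^sup>2)\<^sup>2) \<le> 9 * (real (card ?Q) * ?F\<^sup>2)"
      using sum_sign_form_power4_le[of "{1..k}" "{1..k}" \<delta>]
      unfolding cardQ by (simp add: sum.cartesian_product' cube_def frob_norm_power2 mult.assoc)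
  qed (use assms False finite_cube in auto)
  \<comment> \<open>The sign form is four times \<open>bilin\<close>, so its square is 16 times
    larger and the factor 16 leaves the threshold.\<close>
  also have "{q \<in> ?Q. (16 * \<alpha>) * ?F \<le> (case q of (x, y) \<Rightarrow> (?W x y)\<^sup>2)}
      = {(x, y) \<in> ?Q. (bilin k \<delta> x y)\<^sup>2 \<ge> \<alpha> * ?F}"
    by (auto simp: bilin_eq_sign_form[OF assms(1)] power_divide)
  finally show ?thesis .
qed

section \<open>Passage from counting to probability\<close>

text \<open>By independence the pair of vectors is uniform on the product of the cubes, and the
  event splits into finitely many disjoint events on which both vectors are constant.\<close>

lemma measure_indep_uniform_cube:
  assumes "indep_uniform_cube M k X Y"
  shows "measure M {\<omega> \<in> space M. P (X \<omega>) (Y \<omega>)}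
    = card {(x, y) \<in> cube k \<times> cube k. P x y} / card (cube k \<times> cube k)"
proof -
  interpret prob_space M
    using assms by (simp add: indep_uniform_cube_def)
  let ?C = "count_space (cube k)" and ?G = "{(x, y) \<in> cube k \<times> cube k. P x y}"
  have indep: "indep_var ?C X ?C Y"
    and dX: "distr M ?C X = uniform_count_measure (cube k)"
    and dY: "distr M ?C Y = uniform_count_measure (cube k)"
    using assms by (auto simp: indep_uniform_cube_def)
  have X: "X \<in> measurable M ?C" and Y: "Y \<in> measurable M ?C"
    using indep_var_rv1[OF indep] indep_var_rv2[OF indep] .
  have point: "prob {\<omega> \<in> space M. X \<omega> = x \<and> Y \<omega> = y} = 1 / card (cube k \<times> cube k)"
    if "x \<in> cube k" "y \<in> cube k" for x y
  proof -
    \<comment> \<open>The joint event is rewritten as the preimage of a rectangle, the form in which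
      independence turns it into a product.\<close>
    have "prob {\<omega> \<in> space M. X \<omega> = x \<and> Y \<omega> = y}
        = prob ((\<lambda>\<omega>. (X \<omega>, Y \<omega>)) -` ({x} \<times> {y}) \<inter> space M)"
      by (intro arg_cong[where f = prob]) auto
    also have "\<dots> = prob (X -` {x} \<inter> space M) * prob (Y -` {y} \<inter> space M)"
      using that by (intro indep_varD[OF indep]) auto
    also have "prob (X -` {x} \<inter> space M) = measure (distr M ?C X) {x}"
      using that by (simp add: measure_distr X)
    also have "prob (Y -` {y} \<inter> space M) = measure (distr M ?C Y) {y}"
      using that by (simp add: measure_distr Y)
    finally show ?thesis
      using that by (simp add: dX dY measure_uniform_count_measure finite_cube card_cartesian_product)
  qed
  have range: "X \<omega> \<in> cube k" "Y \<omega> \<in> cube k" if "\<omega> \<in> space M" for \<omega>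
    using that measurable_space[OF X] measurable_space[OF Y] by auto
  \<comment> \<open>The union exhausts the event because both vectors take all their values in the
    cube.\<close>
  have "{\<omega> \<in> space M. P (X \<omega>) (Y \<omega>)} = (\<Union>q\<in>?G. {\<omega> \<in> space M. X \<omega> = fst q \<and> Y \<omega> = snd q})"
    using range by auto
  also have "prob \<dots> = (\<Sum>q\<in>?G. prob {\<omega> \<in> space M. X \<omega> = fst q \<and> Y \<omega> = snd q})"
  proof (rule finite_measure_finite_Union)
    show "finite ?G"
      by (rule finite_subset[of _ "cube k \<times> cube k"]) (auto simp: finite_cube)
    show "(\<lambda>q. {\<omega> \<in> space M. X \<omega> = fst q \<and> Y \<omega> = snd q}) ` ?G \<subseteq> events"
    proof safe
      fix x y assume "x \<in> cube k" "y \<in> cube k"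
      then have "X -` {x} \<inter> space M \<in> events" "Y -` {y} \<inter> space M \<in> events"
        using measurable_sets[OF X, of "{x}"] measurable_sets[OF Y, of "{y}"] by auto
      then have "(X -` {x} \<inter> space M) \<inter> (Y -` {y} \<inter> space M) \<in> events"
        by (rule sets.Int)
      also have "(X -` {x} \<inter> space M) \<inter> (Y -` {y} \<inter> space M)
          = {\<omega> \<in> space M. X \<omega> = fst (x, y) \<and> Y \<omega> = snd (x, y)}"
        by auto
      finally show "{\<omega> \<in> space M. X \<omega> = fst (x, y) \<and> Y \<omega> = snd (x, y)} \<in> events" .
    qed
    show "disjoint_family_on (\<lambda>q. {\<omega> \<in> space M. X \<omega> = fst q \<and> Y \<omega> = snd q}) ?G"
      by (auto simp: disjoint_family_on_def)
  qed
  also have "\<dots> = (\<Sum>q\<in>?G. 1 / card (cube k \<times> cube k))"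
    by (intro sum.cong refl) (auto intro: point)
  finally show ?thesis
    by simp
qed

lemma measure_bilin_ge:
  assumes "zero_line_sums k \<delta>" "indep_uniform_cube M k X Y" "0 \<le> \<alpha>" "\<alpha> \<le> 1 / 16"
  shows "(1 - 16 * \<alpha>)\<^sup>2 / 9
    \<le> measure M {\<omega> \<in> space M. (bilin k \<delta> (X \<omega>) (Y \<omega>))\<^sup>2 \<ge> \<alpha> * (frob_norm k \<delta>)\<^sup>2}"
proof -
  have "0 < card (cube k \<times> cube k)"
    by (simp add: card_cartesian_product card_cube)
  then show ?thesis
    unfolding measure_indep_uniform_cube[OF assms(2), of "\<lambda>x y. (bilin k \<delta> x y)\<^sup>2 \<ge> \<alpha> * (frob_norm k \<delta>)\<^sup>2"]
    using card_bilin_ge[OF assms(1,3,4)] by (simp add: field_simps del: card_cartesian_product)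
qed

theorem theorem7:
  fixes \<alpha> :: real
  assumes "0 < \<alpha>" and "\<alpha> < 1 / 16"
  shows
    "(\<exists>c>0. \<forall>k\<ge>1. \<forall>\<delta> (M :: 'a measure) X Y.
        zero_line_sums k \<delta> \<longrightarrow> indep_uniform_cube M k X Y \<longrightarrow>
        measure M {\<omega> \<in> space M. (bilin k \<delta> (X \<omega>) (Y \<omega>))\<^sup>2 \<ge> \<alpha> * (frob_norm k \<delta>)\<^sup>2} \<ge> c) \<and>
     (1 - 16 * \<alpha>)\<^sup>2 / 1024 > 0 \<and>
     (\<forall>k\<ge>1. \<forall>\<delta> (M :: 'a measure) X Y.
        zero_line_sums k \<delta> \<longrightarrow> indep_uniform_cube M k X Y \<longrightarrow>
        measure M {\<omega> \<in> space M. (bilin k \<delta> (X \<omega>) (Y \<omega>))\<^sup>2 \<ge> \<alpha> * (frob_norm k \<delta>)\<^sup>2}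
          \<ge> (1 - 16 * \<alpha>)\<^sup>2 / 1024)"
proof -
  let ?c = "(1 - 16 * \<alpha>)\<^sup>2 / 1024"
  have pos: "?c > 0"
    using assms by simp
  have bound: "?c \<le> measure M {\<omega> \<in> space M. (bilin k \<delta> (X \<omega>) (Y \<omega>))\<^sup>2 \<ge> \<alpha> * (frob_norm k \<delta>)\<^sup>2}"
    if "zero_line_sums k \<delta>" "indep_uniform_cube M k X Y" for k \<delta> X Y and M :: "'a measure"
  proof -
    \<comment> \<open>The moment bounds give the denominator 9, which is stronger than the required
      1024.\<close>
    have "?c \<le> (1 - 16 * \<alpha>)\<^sup>2 / 9"
      by (intro divide_left_mono) auto
    then show ?thesis
      using measure_bilin_ge[OF that, of \<alpha>] assms by linarith
  qed
  \<comment> \<open>The witness for the existential claim is \<open>?c\<close> itself, which depends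
    on \<alpha> alone.\<close>
  show ?thesis
    using pos bound by blast
qed

end
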